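(* Let $s$ be a weak composition. The cover relations of the $s$-weak order on $s$-decreasing trees are in correspondence with $s$-tree rotations; that is, for $s$-decreasing trees $T,T'$, the tree $T'$ covers $T$ in the $s$-weak order if and only if there is a tree-ascent $(a,c)$ of $T$ such that $$\operatorname{inv}(T')=\bigl(\operatorname{inv}(T)+(c,a)\bigr)^{\mathsf{tc}}.$$
   Context: A weak composition is a finite sequence $s=(s(1),\dots,s(n))$ of nonnegative integers. An $s$-decreasing tree is a rooted planar tree with exactly $n$ internal nodes, labelled bijectively by $1,\dots,n$ (an internal node is identified with its label; the other nodes are unlabelled leaves), such that internal node $i$ has exactly $s(i)+1$ ordered children and all internal nodes that are descendants of $i$ have labels smaller than $i$. For a node $y$ of $T$, $T^y_0,\dots,T^y_{s(y)}$ denote its child subtrees from left to right, and $x\in T^y_i$ means that internal node $x$ lies in that subtree. If $x<y$ and $x$ is not a descendant of $y$, let $z$ be the first (closest) common ancestor of $x$ and $y$, with $x\in T^z_j$, $y\in T^z_i$, $i\neq j$; $x$ is left of $y$ if $j<i$ and right of $y$ if $j>i$. For $x<y$ the cardinality $\#_T(y,x)$ is: $0$ if $x$ is left of $y$; $i$ if $x\in T^y_i$; $s(y)$ if $x$ is right of $y$. The multiset of tree-inversions $\operatorname{inv}(T)$ is the multiset of pairs $(y,x)$, $1\le x<y\le n$, where $(y,x)$ has multiplicity $\#_T(y,x)$; $T$ is determined by $\operatorname{inv}(T)$. The $s$-weak order is defined by $R\preccurlyeq T$ iff $\#_R(y,x)\le \#_T(y,x)$ for all $1\le x<y\le n$.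 A multi inversion set $I$ is a multiset of pairs $(y,x)$ with $1\le x<y\le n$; $\#_I(y,x)$ is the multiplicity of $(y,x)$. $I+(y,x)$ is obtained from $I$ by increasing $\#_I(y,x)$ by one. A transitivity path of $I$ between $c>a$ is a list $c=b_1>b_2>\dots>b_k=a$, $k\ge2$, with $\#_I(b_i,b_{i+1})>0$ for $1\le i<k$. The transitive closure $I^{\mathsf{tc}}$ is defined by letting $\#_{I^{\mathsf{tc}}}(c,a)$ be the maximal value of $\#_I(b_1,b_2)$ over all transitivity paths of $I$ between $c$ and $a$ ($0$ if there is none). A pair $(a,c)$ with $a<c$ is a tree-ascent of $T$ if: (i) $a$ is a descendant of $c$; (ii) $a\notin T^c_{s(c)}$; (iii) if $a$ is a descendant of $b$ with $c>b>a$, then $a\in T^b_{s(b)}$; (iv) if $s(a)>0$, then $T^a_{s(a)}$ contains no internal node (is a leaf). For a tree-ascent $(a,c)$ of $T$, the $s$-decreasing tree whose multiset of tree-inversions is $(\operatorname{inv}(T)+(c,a))^{\mathsf{tc}}$ is called an $s$-tree rotation of $T$. *)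

theory Defs
  imports Main "HOL-Library.Multiset"
begin

section \<open>Decreasing trees of a weak composition\<close>

text \<open>A weak composition is any \<^typ>\<open>nat list\<close>; lists are indexed from 0, its parts from 1.\<close>

definition part :: "nat list \<Rightarrow> nat \<Rightarrow> nat" where
  "part s i = s ! (i - 1)"

datatype tree = Leaf | Node nat "tree list"

fun labels :: "tree \<Rightarrow> nat list" where
  "labels Leaf = []"
| "labels (Node i ts) = i # concat (map labels ts)"

fun subtrees :: "tree \<Rightarrow> tree set" where
  "subtrees Leaf = {Leaf}"
| "subtrees (Node i ts) = insert (Node i ts) (\<Union>t\<in>set ts. subtrees t)"

definition decreasing_tree :: "nat list \<Rightarrow> tree \<Rightarrow> bool" where
  "decreasing_tree s T \<longleftrightarrow>
     distinct (labels T) \<and> set (labels T) = {1..length s} \<and>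
     (\<forall>i ts. Node i ts \<in> subtrees T \<longrightarrow>
        length ts = part s i + 1 \<and> (\<forall>t\<in>set ts. \<forall>j\<in>set (labels t). j < i))"

text \<open>\<open>in_child T y i x\<close> is the relation $x \in T^y_i$. In a tree with distinct labels, the node
  \<open>y\<close> has a unique list of children and \<open>i\<close> is determined by \<open>x\<close> and \<open>y\<close>.\<close>

definition in_child :: "tree \<Rightarrow> nat \<Rightarrow> nat \<Rightarrow> nat \<Rightarrow> bool" where
  "in_child T y i x \<longleftrightarrow>
     (\<exists>ts. Node y ts \<in> subtrees T \<and> i < length ts \<and> x \<in> set (labels (ts ! i)))"

definition descendant :: "tree \<Rightarrow> nat \<Rightarrow> nat \<Rightarrow> bool" where
  "descendant T x y \<longleftrightarrow> (\<exists>i. in_child T y i x)"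

definition common_ancestor :: "tree \<Rightarrow> nat \<Rightarrow> nat \<Rightarrow> nat \<Rightarrow> bool" where
  "common_ancestor T x y z \<longleftrightarrow> descendant T x z \<and> descendant T y z"

definition first_common_ancestor :: "tree \<Rightarrow> nat \<Rightarrow> nat \<Rightarrow> nat \<Rightarrow> bool" where
  "first_common_ancestor T x y z \<longleftrightarrow>
     common_ancestor T x y z \<and>
     (\<forall>w. common_ancestor T x y w \<longrightarrow> w = z \<or> descendant T z w)"

definition left_of :: "tree \<Rightarrow> nat \<Rightarrow> nat \<Rightarrow> bool" where
  "left_of T x y \<longleftrightarrow>
     (\<exists>z j i. first_common_ancestor T x y z \<and> in_child T z j x \<and> in_child T z i y \<and> j < i)"

definition right_of :: "tree \<Rightarrow> nat \<Rightarrow> nat \<Rightarrow> bool" where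
  "right_of T x y \<longleftrightarrow>
     (\<exists>z j i. first_common_ancestor T x y z \<and> in_child T z j x \<and> in_child T z i y \<and> j > i)"


section \<open>Tree-inversions and the weak order\<close>

text \<open>Meaningful for \<open>1 \<le> x < y \<le> length s\<close>: then \<open>y\<close> is not a descendant of \<open>x\<close>, so in the last
  case \<open>x\<close> is a descendant of \<open>y\<close>.\<close>

definition inv_card :: "nat list \<Rightarrow> tree \<Rightarrow> nat \<Rightarrow> nat \<Rightarrow> nat" where
  "inv_card s T y x =
     (if left_of T x y then 0
      else if right_of T x y then part s y
      else (THE i. in_child T y i x))"

definition index_pairs :: "nat \<Rightarrow> (nat \<times> nat) set" where
  "index_pairs n = {(y, x). 1 \<le> x \<and> x < y \<and> y \<le> n}"

definition tree_inversions :: "nat list \<Rightarrow> tree \<Rightarrow> (nat \<times> nat) multiset" where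
  "tree_inversions s T =
     (\<Sum>(y, x)\<in>index_pairs (length s). replicate_mset (inv_card s T y x) (y, x))"

definition weak_le :: "nat list \<Rightarrow> tree \<Rightarrow> tree \<Rightarrow> bool" where
  "weak_le s R T \<longleftrightarrow>
     (\<forall>x y. 1 \<le> x \<and> x < y \<and> y \<le> length s \<longrightarrow> inv_card s R y x \<le> inv_card s T y x)"

definition weak_less :: "nat list \<Rightarrow> tree \<Rightarrow> tree \<Rightarrow> bool" where
  "weak_less s R T \<longleftrightarrow> weak_le s R T \<and> R \<noteq> T"

text \<open>\<open>covers s T' T\<close>: \<open>T'\<close> covers \<open>T\<close> in the poset of decreasing trees of \<open>s\<close>.\<close>

definition covers :: "nat list \<Rightarrow> tree \<Rightarrow> tree \<Rightarrow> bool" where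
  "covers s T' T \<longleftrightarrow>
     decreasing_tree s T \<and> decreasing_tree s T' \<and> weak_less s T T' \<and>
     \<not> (\<exists>U. decreasing_tree s U \<and> weak_less s T U \<and> weak_less s U T')"


section \<open>Transitive closure of a multi inversion set\<close>

definition transitivity_path ::
    "(nat \<times> nat) multiset \<Rightarrow> nat \<Rightarrow> nat \<Rightarrow> nat list \<Rightarrow> bool" where
  "transitivity_path I c a bs \<longleftrightarrow>
     length bs \<ge> 2 \<and> hd bs = c \<and> last bs = a \<and>
     (\<forall>i. Suc i < length bs \<longrightarrow>
        bs ! i > bs ! Suc i \<and> count I (bs ! i, bs ! Suc i) > 0)"

definition tc_card :: "(nat \<times> nat) multiset \<Rightarrow> nat \<Rightarrow> nat \<Rightarrow> nat" where
  "tc_card I c a =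
     Max (insert 0 {count I (bs ! 0, bs ! 1) | bs. transitivity_path I c a bs})"

text \<open>The sum ranges over a finite set of pairs outside of which \<^const>\<open>tc_card\<close> vanishes; see
  \<open>count_tc\<close>.\<close>

definition tc :: "(nat \<times> nat) multiset \<Rightarrow> (nat \<times> nat) multiset" where
  "tc I = (\<Sum>(c, a)\<in>fst ` set_mset I \<times> snd ` set_mset I. replicate_mset (tc_card I c a) (c, a))"


section \<open>Tree-ascents\<close>

definition tree_ascent :: "nat list \<Rightarrow> tree \<Rightarrow> nat \<Rightarrow> nat \<Rightarrow> bool" where
  "tree_ascent s T a c \<longleftrightarrow>
     a < c \<and>
     descendant T a c \<and>
     \<not> in_child T c (part s c) a \<and>
     (\<forall>b. c > b \<and> b > a \<and> descendant T a b \<longrightarrow> in_child T b (part s b) a) \<and>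
     (part s a > 0 \<longrightarrow> (\<forall>x. \<not> in_child T a (part s a) x))"


section \<open>Multiplicities\<close>

lemma count_sum_replicate:
  assumes "finite A"
  shows "count (\<Sum>p\<in>A. replicate_mset (f p) p) q = (if q \<in> A then f q else 0)"
  using assms by (induction A) auto

lemma count_tree_inversions:
  "count (tree_inversions s T) (y, x) =
     (if 1 \<le> x \<and> x < y \<and> y \<le> length s then inv_card s T y x else 0)"
proof -
  have "finite (index_pairs (length s))"
    by (rule finite_subset[of _ "{..length s} \<times> {..length s}"]) (auto simp: index_pairs_def)
  from count_sum_replicate[OF this, of "\<lambda>p. inv_card s T (fst p) (snd p)" "(y, x)"]
  show ?thesis
    by (simp add: tree_inversions_def case_prod_unfold) (auto simp: index_pairs_def)
qed

lemma tc_card_eq_0: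
  assumes "(c, a) \<notin> fst ` set_mset I \<times> snd ` set_mset I"
  shows "tc_card I c a = 0"
proof -
  have False if "transitivity_path I c a bs" for bs
  proof -
    have len: "length bs \<ge> 2" and c: "hd bs = c" and a: "last bs = a"
      and st: "\<And>i. Suc i < length bs \<Longrightarrow> (bs ! i, bs ! Suc i) \<in># I"
      using that by (auto simp: transitivity_path_def)
    have "bs \<noteq> []" using len by auto
    then have "bs ! 0 = c" "bs ! (length bs - 1) = a"
      using c a by (auto simp: hd_conv_nth last_conv_nth)
    moreover have "Suc (length bs - 2) = length bs - 1" using len by simp
    ultimately have "(c, bs ! 1) \<in># I" "(bs ! (length bs - 2), a) \<in># I"
      using st[of 0] st[of "length bs - 2"] len by auto
    then show False using assms by force
  qed
  then have "{count I (bs ! 0, bs ! 1) | bs. transitivity_path I c a bs} = {}" by blast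
  then show ?thesis by (simp only: tc_card_def) simp
qed

lemma count_tc: "count (tc I) (c, a) = tc_card I c a"
proof -
  have "finite (fst ` set_mset I \<times> snd ` set_mset I)" by simp
  from count_sum_replicate[OF this, of "\<lambda>p. tc_card I (fst p) (snd p)" "(c, a)"]
  show ?thesis
    using tc_card_eq_0[of c a I] by (auto simp: tc_def case_prod_unfold)
qed

text \<open>The set under \<^const>\<open>Max\<close> in \<^const>\<open>tc_card\<close> is finite.\<close>

lemma finite_tc_values:
  "finite {count I (bs ! 0, bs ! 1) | bs. transitivity_path I c a bs}"
  by (rule finite_subset[of _ "{..size I}"]) (auto simp: count_le_size)

end

(*
The inversion multiplicities f y x of a tree are exactly the functions that are bounded by s,
transitive (f y x = 0 or f z x >= f z y for x < y < z) and planar (f y x = s(y) or f z y >= f z x):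
the multiplicities at the largest label say which label lies in which child of the root, and one
recurses.  Moreover x is a descendant of y iff f z x = f z y for all z > y.  This turns the
theorem into a statement about such functions.  For a tree-ascent (a, c) the closure of inv(T) + (c, a)
only raises the entries (c, x) with x = a or f a x > 0 to at least f c a + 1, and the result is again
transitive and planar.  If f < g, then there is a tree-ascent (a, c) of f with f c a < g c a, and g lies
above the rotation at (a, c) by transitivity.  Hence every cover is a rotation.  Conversely, (a, c) is
the only tree-ascent of f whose multiplicity is raised by the rotation at (a, c), so nothing lies
strictly between f and that rotation.
*)

theory Submission
  imports Defs
begin

section \<open>Inversion functions\<close>

text \<open>The index set is an arbitrary finite \<open>X\<close> because the labels of a subtree
  need not form an interval, and \<open>exists_tree\<close> recurses on such sets.\<close>

locale inversion_function =
  fixes X :: "nat set" and r :: "nat \<Rightarrow> nat" and f :: "nat \<Rightarrow> nat \<Rightarrow> nat"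
  assumes finite_X: "finite X"
    and bound: "\<lbrakk>x \<in> X; y \<in> X; x < y\<rbrakk> \<Longrightarrow> f y x \<le> r y"
    and transitive: "\<lbrakk>x \<in> X; y \<in> X; z \<in> X; x < y; y < z; 0 < f y x\<rbrakk> \<Longrightarrow> f z y \<le> f z x"
    and planar: "\<lbrakk>x \<in> X; y \<in> X; z \<in> X; x < y; y < z; f y x < r y\<rbrakk> \<Longrightarrow> f z x \<le> f z y"
begin

section \<open>Descendants, ascents and separating ancestors\<close>

definition below :: "nat \<Rightarrow> nat \<Rightarrow> bool" where
  "below x y \<longleftrightarrow> x \<in> X \<and> y \<in> X \<and> x < y \<and> (\<forall>z\<in>X. y < z \<longrightarrow> f z x = f z y)"

text \<open>Condition (iii) of a tree-ascent, kept apart from \<open>ascent\<close> because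
  \<open>exists_ascent\<close> minimises over the labels that satisfy it.\<close>

definition rightmost_below :: "nat \<Rightarrow> nat \<Rightarrow> bool" where
  "rightmost_below a c \<longleftrightarrow> (\<forall>b. a < b \<and> b < c \<and> below a b \<longrightarrow> f b a = r b)"

definition ascent :: "nat \<Rightarrow> nat \<Rightarrow> bool" where
  "ascent a c \<longleftrightarrow> below a c \<and> f c a < r c \<and> rightmost_below a c \<and>
     (0 < r a \<longrightarrow> (\<forall>x. \<not> (below x a \<and> f a x = r a)))"

text \<open>A closed form of the transitive closure after \<open>(c, a)\<close> is added:
  \<open>0 < f a x\<close> means that the path from \<open>c\<close> over \<open>a\<close> to
  \<open>x\<close> exists, and \<open>max\<close> keeps an entry that is already larger.\<close>

definition rotation :: "nat \<Rightarrow> nat \<Rightarrow> nat \<Rightarrow> nat \<Rightarrow> nat" where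
  "rotation a c y x =
     (if y = c \<and> (x = a \<or> x < a \<and> 0 < f a x) then max (f c x) (Suc (f c a)) else f y x)"

lemma below_trans: "below x y \<Longrightarrow> below y z \<Longrightarrow> below x z"
  unfolding below_def by auto

lemma below_chain: "below x b \<Longrightarrow> below x a \<Longrightarrow> b < a \<Longrightarrow> below b a"
  unfolding below_def by auto

text \<open>For \<open>w > z\<close>, planarity gives \<open>f w p \<le> f w z\<close> because
  \<open>f z p < f z q \<le> r z\<close>, and transitivity gives \<open>f w z \<le> f w q\<close>
  because \<open>f z q > 0\<close>. As \<open>f w p = f w q\<close>, both are equalities.\<close>

lemma below_if_last_difference:
  assumes X: "p \<in> X" "q \<in> X" "z \<in> X" and less: "p < z" "q < z" and diff: "f z p < f z q"
    and eq: "\<And>w. w \<in> X \<Longrightarrow> z < w \<Longrightarrow> f w p = f w q"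
  shows "below p z"
proof -
  have "f w p = f w z" if w: "w \<in> X" "z < w" for w
  proof -
    have "f z p < r z" using bound[of q z] X less diff by simp
    then have "f w p \<le> f w z" using planar[of p z w] X less w by simp
    moreover have "f w z \<le> f w q" using transitive[of q z w] X less w diff by simp
    ultimately show ?thesis using eq[OF w] by simp
  qed
  then show ?thesis using X less by (simp add: below_def)
qed

text \<open>Take the largest \<open>z\<close> at which the entries of \<open>p\<close> and
  \<open>q\<close> differ: \<open>mono\<close> fixes the direction of the inequality and
  \<open>above\<close> forces \<open>z < c\<close>. Since then \<open>f z p < r z\<close>, such a
  \<open>z\<close> contradicts \<open>rightmost_below p c\<close> wherever that is assumed.\<close>

lemma separating_ancestor:
  assumes X: "p \<in> X" "q \<in> X" and zeX: "z0 \<in> X" and less: "p < z0" "q < z0" and ne: "f z0 p \<noteq> f z0 q"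
    and mono: "\<And>w. w \<in> X \<Longrightarrow> z0 \<le> w \<Longrightarrow> f w p \<le> f w q"
    and above: "\<And>w. w \<in> X \<Longrightarrow> c \<le> w \<Longrightarrow> f w p = f w q"
  obtains z where "z \<in> X" "z0 \<le> z" "z < c" "below p z" "f z p < f z q"
proof -
  define Z where "Z = {w \<in> X. z0 \<le> w \<and> f w p \<noteq> f w q}"
  have fin: "finite Z" and nonempty: "Z \<noteq> {}"
    using finite_X zeX ne by (auto simp: Z_def)
  define z where "z = Max Z"
  have zZ: "z \<in> Z" unfolding z_def using fin nonempty by (rule Max_in)
  have eq: "f w p = f w q" if "w \<in> X" "z < w" for w
    using Max_ge[OF fin, of w] that zZ unfolding z_def[symmetric] by (force simp: Z_def)
  have diff: "f z p < f z q" using zZ mono[of z] by (auto simp: Z_def)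
  have "below p z" using below_if_last_difference[OF X _ _ _ diff eq] zZ less by (auto simp: Z_def)
  moreover have "z < c" using above[of z] diff zZ by (force simp: Z_def)
  ultimately show ?thesis using that[of z] zZ diff by (auto simp: Z_def)
qed

section \<open>Rotations are again inversion functions\<close>

lemma rotation_ge: "f y x \<le> rotation a c y x"
  unfolding rotation_def by simp

lemma rotation_self: "rotation a c c a = Suc (f c a)"
  unfolding rotation_def by simp

lemma rotation_other: "y \<noteq> c \<Longrightarrow> rotation a c y x = f y x"
  unfolding rotation_def by simp

text \<open>If \<open>f y a < r y\<close>, then \<open>a\<close> is not below \<open>y\<close> by
  \<open>rightmost_below\<close>, so some higher label tells them apart. Planarity at
  \<open>y\<close> orders their entries, and the resulting separating ancestor of \<open>a\<close>
  contradicts \<open>rightmost_below a c\<close>.\<close>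

lemma planar_at_rotation:
  assumes asc: "ascent a c" and y: "y \<in> X" "a < y" "y < c" and same: "f c y = f c a"
  shows "f y a = r y"
proof (rule ccontr)
  assume "f y a \<noteq> r y"
  have a: "a \<in> X" "c \<in> X" "a < c" and bel: "below a c" and fc: "f c a < r c"
    and rb: "rightmost_below a c"
    using asc by (auto simp: ascent_def below_def)
  have lt: "f y a < r y" using \<open>f y a \<noteq> r y\<close> bound[of a y] a y by simp
  have "\<not> below a y" using rb y lt unfolding rightmost_below_def by (metis less_irrefl)
  then obtain z0 where z0: "z0 \<in> X" "y < z0" "f z0 a \<noteq> f z0 y"
    using a y by (auto simp: below_def)
  have mono: "f w a \<le> f w y" if "w \<in> X" "z0 \<le> w" for w
    using planar[of a y w] a y lt that z0 by simp
  have above: "f w a = f w y" if w: "w \<in> X" "c \<le> w" for w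
  proof (cases "w = c")
    case False
    then have "f w y \<le> f w c" using planar[of y c w] y a w same fc by simp
    moreover have "f w c = f w a" using bel w False by (simp add: below_def)
    ultimately show ?thesis
      using planar[of a y w] a y lt w by simp
  qed (simp add: same)
  obtain z where "z \<in> X" "z0 \<le> z" "z < c" "below a z" "f z a < f z y"
    using separating_ancestor[of a y z0 c] a y z0 mono above by auto
  then show False
    using rb bound[of y z] y z0 a unfolding rightmost_below_def by fastforce
qed

text \<open>The raised set \<open>A\<close> is closed under positive entries, which preserves
  transitivity. Planarity could only fail where \<open>x\<close> is raised, \<open>y\<close> is not,
  and both have the old entry \<open>f c a\<close>. For \<open>a < y\<close> this is excluded by
  \<open>planar_at_rotation\<close>, for \<open>y < a\<close> by planarity at
  \<open>x < y < a\<close>.\<close>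

lemma inversion_function_rotation:
  assumes asc: "ascent a c"
  shows "inversion_function X r (rotation a c)"
proof -
  have a: "a \<in> X" "c \<in> X" "a < c" and bel: "below a c" and fc: "f c a < r c"
    and rb: "rightmost_below a c"
    using asc by (auto simp: ascent_def below_def)
  define A where "A x \<longleftrightarrow> x = a \<or> x < a \<and> 0 < f a x" for x
  have rot: "rotation a c y x = (if y = c \<and> A x then max (f c x) (Suc (f c a)) else f y x)" for x y
    by (simp add: rotation_def A_def)
  have A_ge: "f c a \<le> f c x" if "A x" "x \<in> X" for x
    using that transitive[of x a c] a by (auto simp: A_def)
  have bnd: "rotation a c y x \<le> r y" if "x \<in> X" "y \<in> X" "x < y" for x y
    using that fc bound[of x y] by (auto simp: rot)
  show ?thesis
  proof
    show "finite X" by (rule finite_X)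
    show "rotation a c y x \<le> r y" if "x \<in> X" "y \<in> X" "x < y" for x y
      using bnd that .
    show "rotation a c z y \<le> rotation a c z x"
      if x: "x \<in> X" "y \<in> X" "z \<in> X" "x < y" "y < z" and pos: "0 < rotation a c y x" for x y z
    proof (cases "y = c")
      case True
      then have "z \<noteq> c" using x by simp
      \<comment> \<open>The entry \<open>(c, x)\<close> may be positive only after the rotation.
        Then \<open>f z c = f z a\<close>, as \<open>a\<close> is below \<open>c\<close>, and
        transitivity at \<open>x < a < z\<close> replaces the missing instance at
        \<open>c\<close>.\<close>
      have "f z c \<le> f z x"
      proof (cases "0 < f c x")
        case True
        then show ?thesis using transitive[of x c z] x \<open>y = c\<close> by simp
      next
        case False
        then have "A x" using pos \<open>y = c\<close> by (simp add: rot split: if_splits)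
        moreover have "f z a = f z c" using bel x \<open>y = c\<close> by (simp add: below_def)
        ultimately show ?thesis using transitive[of x a z] x a \<open>y = c\<close> by (auto simp: A_def)
      qed
      then show ?thesis using \<open>z \<noteq> c\<close> True by (simp add: rotation_other)
    next
      case False
      then have fyx: "0 < f y x" using pos by (simp add: rotation_other)
      have le: "f z y \<le> f z x" using transitive[of x y z] x fyx by simp
      have "A x" if "A y"
        using that transitive[of x y a] x fyx a by (auto simp: A_def)
      then show ?thesis using le by (auto simp: rot)
    qed
    show "rotation a c z x \<le> rotation a c z y"
      if x: "x \<in> X" "y \<in> X" "z \<in> X" "x < y" "y < z" and less: "rotation a c y x < r y" for x y z
    proof -
      have fyx: "f y x < r y" using less rotation_ge[of y x a c] by simp
      have le: "f z x \<le> f z y" using planar[of x y z] x fyx by simp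
      have "f c a < f c y" if "z = c" "A x" "\<not> A y" "f c x = f c a"
      proof (rule ccontr)
        assume "\<not> f c a < f c y"
        then have same: "f c y = f c a" using le that by simp
        show False
        proof (cases "a < y")
          case True
          then have "f y a = r y" using planar_at_rotation[OF asc] x that same by simp
          then show False using fyx that(2) transitive[of x a y] x a True by (auto simp: A_def)
        next
          case False
          then have "y < a" using that(3) by (auto simp: A_def)
          then show False
            using planar[of x y a] x a fyx that by (auto simp: A_def)
        qed
      qed
      then show ?thesis using le A_ge[of x] x by (cases "f c x = f c a") (auto simp: rot)
    qed
  qed
qed

section \<open>Comparison with larger inversion functions\<close>

lemma rotation_le:
  assumes "inversion_function X r g" and asc: "ascent a c"
    and le: "\<And>x y. \<lbrakk>x \<in> X; y \<in> X; x < y\<rbrakk> \<Longrightarrow> f y x \<le> g y x" and less: "f c a < g c a"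
    and x: "x \<in> X" "y \<in> X" "x < y"
  shows "rotation a c y x \<le> g y x"
proof -
  interpret g: inversion_function X r g by fact
  have a: "a \<in> X" "c \<in> X" "a < c" using asc by (auto simp: ascent_def below_def)
  \<comment> \<open>Here \<open>g a x \<ge> f a x > 0\<close>, so transitivity of \<open>g\<close>
    carries \<open>g c a > f c a\<close> over to \<open>x\<close>.\<close>
  have "Suc (f c a) \<le> g c x" if "x < a" "0 < f a x"
    using g.transitive[of x a c] le[of x a] that a x less by simp
  then show ?thesis using le[OF x] less by (auto simp: rotation_def)
qed

text \<open>Choose \<open>c\<close> minimal with some \<open>a\<close> below it such that \<open>f c a < g c a\<close>. The largest such \<open>a\<close>
  satisfies \<^const>\<open>rightmost_below\<close>; the smallest \<open>a\<close> satisfying it has an empty last subtree.\<close>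

lemma exists_ascent:
  assumes "inversion_function X r g"
    and le: "\<And>x y. \<lbrakk>x \<in> X; y \<in> X; x < y\<rbrakk> \<Longrightarrow> f y x \<le> g y x"
    and ne: "x0 \<in> X" "y0 \<in> X" "x0 < y0" "f y0 x0 \<noteq> g y0 x0"
  obtains a c where "ascent a c" "f c a < g c a"
proof -
  interpret g: inversion_function X r g by fact
  define D where "D c a \<longleftrightarrow> below a c \<and> f c a < g c a" for c a
  \<comment> \<open>The largest \<open>c\<close> with \<open>f c x0 < g c x0\<close> works: for
    \<open>z > c\<close>, the chain
    \<open>f z x0 \<le> f z c \<le> g z c \<le> g z x0 = f z x0\<close> shows that \<open>x0\<close>
    is below \<open>c\<close>.\<close>
  have "\<exists>c. D c x0"
  proof -
    define C where "C = {y \<in> X. x0 < y \<and> f y x0 < g y x0}"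
    have fin: "finite C" and nonempty: "C \<noteq> {}"
      using finite_X ne le[of x0 y0] by (auto simp: C_def)
    define c where "c = Max C"
    have cC: "c \<in> C" unfolding c_def using fin nonempty by (rule Max_in)
    have max: "g z x0 = f z x0" if "z \<in> X" "c < z" for z
      using Max_ge[OF fin, of z] that cC le[of x0 z] ne unfolding c_def[symmetric]
      by (force simp: C_def)
    have "f z x0 = f z c" if z: "z \<in> X" "c < z" for z
    proof (rule antisym)
      have "f c x0 < r c" using cC g.bound[of x0 c] ne by (simp add: C_def)
      then show "f z x0 \<le> f z c" using planar[of x0 c z] z cC ne by (simp add: C_def)
      have "g z c \<le> g z x0" using g.transitive[of x0 c z] z cC ne by (simp add: C_def)
      then show "f z c \<le> f z x0" using max[OF z] le[of c z] z cC by (simp add: C_def)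
    qed
    then have "D c x0" using cC ne by (simp add: D_def below_def C_def)
    then show ?thesis ..
  qed
  then have ex: "\<exists>c a. D c a" by blast
  define c where "c = (LEAST c. \<exists>a. D c a)"
  have exa: "\<exists>a. D c a" unfolding c_def using LeastI_ex[OF ex] .
  have cmin: "\<not> D b a" if "b < c" for b a
    using not_less_Least[of b "\<lambda>c. \<exists>a. D c a"] that unfolding c_def by blast
  have ex2: "\<exists>a. D c a \<and> rightmost_below a c"
  proof -
    have fin: "finite {a. D c a}"
      by (rule finite_subset[OF _ finite_X]) (auto simp: D_def below_def)
    define a where "a = Max {a. D c a}"
    have aD: "D c a" using Max_in[OF fin] exa by (auto simp: a_def)
    have max: "\<not> D c b" if "a < b" for b
      using Max_ge[OF fin, of b] that unfolding a_def[symmetric] by auto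
    \<comment> \<open>By minimality of \<open>c\<close>, \<open>f\<close> and \<open>g\<close> agree
      at \<open>(b, a)\<close>. An entry less than \<open>r b\<close> would let planarity of
      \<open>g\<close> pass \<open>g c a > f c a\<close> on to \<open>b\<close>, against the
      maximality of \<open>a\<close>.\<close>
    have "f b a = r b" if b: "a < b" "b < c" "below a b" for b
    proof (rule ccontr)
      assume "f b a \<noteq> r b"
      have X: "a \<in> X" "b \<in> X" "c \<in> X" using aD b by (auto simp: D_def below_def)
      have "f b a < r b" using bound[of a b] X b \<open>f b a \<noteq> r b\<close> by simp
      moreover have "g b a = f b a" using cmin[of b a] b le[of a b] X by (auto simp: D_def)
      ultimately have "g c a \<le> g c b" using g.planar[of a b c] X b by simp
      moreover have "f c a = f c b" using b X by (simp add: below_def)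
      moreover have "below b c" using below_chain[of a b c] aD b by (simp add: D_def)
      ultimately have "D c b" using aD by (simp add: D_def)
      then show False using max[of b] b by simp
    qed
    then show ?thesis using aD by (auto simp: rightmost_below_def)
  qed
  define a where "a = (LEAST a. D c a \<and> rightmost_below a c)"
  have aD: "D c a" and rb: "rightmost_below a c"
    using LeastI_ex[OF ex2] unfolding a_def by auto
  have amin: "\<not> (D c x \<and> rightmost_below x c)" if "x < a" for x
    using not_less_Least[of x] that unfolding a_def by blast
  have X: "a \<in> X" "c \<in> X" "a < c" "below a c" using aD by (auto simp: D_def below_def)
  have leaf: "\<not> (below x' a \<and> f a x' = r a)" if pos: "0 < r a" for x'
  proof
    assume x': "below x' a \<and> f a x' = r a"
    define S where "S = {x. below x a \<and> f a x = r a}"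
    have fin: "finite S"
      by (rule finite_subset[OF _ finite_X]) (auto simp: S_def below_def)
    \<comment> \<open>\<open>x\<close> is the largest descendant in the last child of
      \<open>a\<close>. As \<open>f a x = r a\<close> cannot grow, \<open>g a x\<close> is positive,
      and transitivity of \<open>g\<close> gives \<open>D c x\<close>. Once
      \<open>rightmost_below x c\<close> is shown, this contradicts the choice of
      \<open>a\<close>.\<close>
    define x where "x = Max S"
    have xS: "x \<in> S" unfolding x_def using fin x' by (intro Max_in) (auto simp: S_def)
    have max: "b \<notin> S" if "x < b" for b
      using Max_ge[OF fin, of b] that unfolding x_def[symmetric] by auto
    have x: "x \<in> X" "x < a" "below x a" "f a x = r a" using xS by (auto simp: S_def below_def)
    have "g a x = f a x" using le[of x a] g.bound[of x a] x X by simp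
    then have "g c a \<le> g c x" using g.transitive[of x a c] x X pos by simp
    moreover have "f c x = f c a" using x X by (simp add: below_def)
    moreover have "below x c" using below_trans x X by blast
    ultimately have "D c x" using aD by (simp add: D_def)
    moreover have "f b x = r b" if b: "x < b" "b < c" "below x b" for b
    proof -
      \<comment> \<open>The ancestors of \<open>x\<close> form a chain through \<open>a\<close>. One
        below \<open>a\<close> would lie in the last child of \<open>a\<close> too, against the
        maximality of \<open>x\<close>; one above \<open>a\<close> has the same entry for
        \<open>x\<close> as for \<open>a\<close>.\<close>
      consider "b < a" | "b = a" | "a < b" by linarith
      then show ?thesis
      proof cases
        case 1
        then have "below b a" using below_chain[of x b a] b x by simp
        moreover have "f a b = f a x" using b 1 X by (simp add: below_def)
        ultimately show ?thesis using max[of b] b x by (simp add: S_def)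
      next
        case 2
        then show ?thesis using x by simp
      next
        case 3
        then have "below a b" using below_chain[of x a b] b x by simp
        then have "f b a = r b" using rb 3 b by (simp add: rightmost_below_def)
        moreover have "f b x = f b a" using x b 3 by (auto simp: below_def)
        ultimately show ?thesis by simp
      qed
    qed
    ultimately show False using amin[of x] x by (simp add: rightmost_below_def)
  qed
  have "f c a < r c" using aD g.bound[of a c] X by (simp add: D_def)
  then have "ascent a c" using leaf rb X by (simp add: ascent_def)
  then show ?thesis using that aD by (simp add: D_def)
qed

text \<open>Only row \<open>c\<close> changes, so a second such ascent has \<open>a' < a\<close>,
  \<open>f a a' > 0\<close> and \<open>f c a' = f c a\<close>. If \<open>a'\<close> is below
  \<open>a\<close>, its rightmost condition puts it into the last child of \<open>a\<close>, which
  has to be empty. Otherwise a separating ancestor of \<open>a\<close> violates the rightmost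
  condition of \<open>a\<close>.\<close>

lemma ascent_unique:
  assumes asc: "ascent a c" and asc': "ascent a' c'" and less: "f c' a' < rotation a c c' a'"
  shows "a' = a \<and> c' = c"
proof (rule ccontr)
  assume "\<not> (a' = a \<and> c' = c)"
  moreover have c': "c' = c" using less rotation_other[of c' c a a'] by auto
  ultimately have "a' \<noteq> a" by simp
  then have a': "a' < a" "0 < f a a'" and le: "f c a' \<le> f c a"
    using less c' by (auto simp: rotation_def split: if_splits)
  have X: "a \<in> X" "c \<in> X" "a' \<in> X" "a < c" and bel: "below a c" "below a' c"
    and rb: "rightmost_below a c" "rightmost_below a' c"
    using asc asc' c' by (auto simp: ascent_def below_def)
  have same: "f c a' = f c a" using transitive[of a' a c] le X a' by simp
  show False
  proof (cases "below a' a")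
    case True
    then have "f a a' = r a" using rb a' X by (simp add: rightmost_below_def)
    then show False using asc True a' by (auto simp: ascent_def)
  next
    case False
    then obtain z0 where z0: "z0 \<in> X" "a < z0" "f z0 a \<noteq> f z0 a'"
      using a' X unfolding below_def by metis
    have mono: "f w a \<le> f w a'" if "w \<in> X" "z0 \<le> w" for w
      using transitive[of a' a w] X a' that z0 by simp
    have above: "f w a = f w a'" if w: "w \<in> X" "c \<le> w" for w
      using bel w same unfolding below_def by (cases "w = c") auto
    obtain z where "z \<in> X" "z0 \<le> z" "z < c" "below a z" "f z a < f z a'"
      using separating_ancestor[of a a' z0 c] a' X z0 mono above by auto
    then show False
      using rb(1) bound[of a' z] X z0 a' unfolding rightmost_below_def by fastforce
  qed
qed

section \<open>Transitive closure after adding an ascent\<close>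

lemma path_le_first:
  assumes count: "\<And>y x. 0 < count I (y, x) \<Longrightarrow> x \<in> X \<and> y \<in> X \<and> x < y \<and> count I (y, x) \<le> f y x"
    and path: "transitivity_path I c a bs"
  shows "a \<in> X \<and> c \<in> X \<and> a < c \<and> count I (bs ! 0, bs ! 1) \<le> f c a"
proof -
  have len: "2 \<le> length bs" and hd: "hd bs = c" and last: "last bs = a"
    and st: "\<And>i. Suc i < length bs \<Longrightarrow> 0 < count I (bs ! i, bs ! Suc i)"
    using path by (auto simp: transitivity_path_def)
  have "bs \<noteq> []" using len by auto
  then have c: "bs ! 0 = c" and a: "bs ! (length bs - 1) = a"
    using hd last by (auto simp: hd_conv_nth last_conv_nth)
  \<comment> \<open>All edges are positive, so by transitivity \<open>f c\<close> does not decrease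
    along the path.\<close>
  have "bs ! Suc i \<in> X \<and> c \<in> X \<and> bs ! Suc i < c \<and> count I (bs ! 0, bs ! 1) \<le> f c (bs ! Suc i)"
    if "Suc i < length bs" for i
    using that
  proof (induction i)
    case 0
    then show ?case using count[OF st[of 0]] c by simp
  next
    case (Suc i)
    have *: "bs ! Suc (Suc i) \<in> X \<and> bs ! Suc i \<in> X \<and> bs ! Suc (Suc i) < bs ! Suc i \<and>
       0 < f (bs ! Suc i) (bs ! Suc (Suc i))"
      using count[OF st[OF Suc.prems]] st[OF Suc.prems] by linarith
    then show ?case
      using Suc transitive[of "bs ! Suc (Suc i)" "bs ! Suc i" c] by simp
  qed
  \<comment> \<open>\<open>Suc (length bs - 2)\<close> is the last position, as a path has at least
    two entries.\<close>
  from this[of "length bs - 2"] len a show ?thesis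
    by (simp add: Suc_diff_Suc numeral_2_eq_2)
qed

text \<open>The upper bound is \<open>path_le_first\<close> for the inversion function
  \<open>rotation a c\<close>. A positive value is attained by the one-edge path, or by
  \<open>[c, a, x]\<close> where \<open>x\<close> is raised through \<open>a\<close>.\<close>

lemma tc_card_rotation:
  assumes asc: "ascent a c"
    and count: "\<And>y x. count I (y, x) = (if x \<in> X \<and> y \<in> X \<and> x < y then f y x else 0)"
  shows "tc_card (add_mset (c, a) I) y x =
    (if x \<in> X \<and> y \<in> X \<and> x < y then rotation a c y x else 0)"
proof -
  let ?I = "add_mset (c, a) I"
  let ?V = "{count ?I (bs ! 0, bs ! 1) | bs. transitivity_path ?I y x bs}"
  interpret g: inversion_function X r "rotation a c"
    by (rule inversion_function_rotation[OF asc])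
  have a: "a \<in> X" "c \<in> X" "a < c" using asc by (auto simp: ascent_def below_def)
  have cnt: "u \<in> X \<and> v \<in> X \<and> u < v \<and> count ?I (v, u) \<le> rotation a c v u"
    if "0 < count ?I (v, u)" for u v
  proof (cases "v = c \<and> u = a")
    case True
    then show ?thesis using a count[of c a] by (simp add: rotation_self)
  next
    case False
    then show ?thesis using that rotation_ge[of v u a c] by (auto simp: count split: if_splits)
  qed
  have upper: "x \<in> X \<and> y \<in> X \<and> x < y \<and> v \<le> rotation a c y x" if "v \<in> ?V" for v
    using g.path_le_first[OF cnt] that by blast
  show ?thesis
  proof (cases "x \<in> X \<and> y \<in> X \<and> x < y")
    case False
    then have "?V = {}" using upper by blast
    then show ?thesis using False by (simp only: tc_card_def) simp
  next
    case True
    have direct: "count ?I (y, x) \<in> ?V" if "0 < count ?I (y, x)"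
    proof -
      have "transitivity_path ?I y x [y, x]"
        using that True by (auto simp: transitivity_path_def)
      then show ?thesis by force
    qed
    have "rotation a c y x \<in> insert 0 ?V"
    proof (cases "y = c \<and> x < a \<and> 0 < f a x \<and> f c x < Suc (f c a)")
      case bent: True
      then have "transitivity_path ?I y x [c, a, x]"
        using True a by (auto simp: transitivity_path_def count less_Suc_eq nth_Cons')
      moreover have "count ?I ([c, a, x] ! 0, [c, a, x] ! 1) = rotation a c y x"
        using bent a by (auto simp: rotation_def count)
      ultimately show ?thesis by (metis (mono_tags, lifting) insertCI mem_Collect_eq)
    next
      case False
      then have "rotation a c y x = count ?I (y, x)"
        using True a by (auto simp: rotation_def count max_def)
      \<comment> \<open>A zero entry is the default value 0 inserted under
        \<open>Max\<close>.\<close>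
      then show ?thesis using direct by (cases "0 < count ?I (y, x)") auto
    qed
    then have "Max (insert 0 ?V) = rotation a c y x"
      using upper finite_tc_values[of ?I y x] by (intro Max_eqI) auto
    then show ?thesis using True by (simp only: tc_card_def) simp
  qed
qed

end

lemma inversion_function_subset:
  assumes "inversion_function X r f" and sub: "Y \<subseteq> X"
  shows "inversion_function Y r f"
proof -
  interpret inversion_function X r f by fact
  show ?thesis
  proof
    show "finite Y" using sub finite_X by (rule finite_subset)
  qed (use sub in \<open>auto intro: bound transitive planar\<close>)
qed

section \<open>Trees and inversion functions\<close>

text \<open>Unlike \<^const>\<open>decreasing_tree\<close>, this is inherited by subtrees.\<close>

definition proper :: "nat list \<Rightarrow> tree \<Rightarrow> bool" where
  "proper s T \<longleftrightarrow> distinct (labels T) \<and>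
     (\<forall>i ts. Node i ts \<in> subtrees T \<longrightarrow>
        length ts = part s i + 1 \<and> (\<forall>t\<in>set ts. \<forall>j\<in>set (labels t). j < i))"

lemma decreasing_tree_iff_proper:
  "decreasing_tree s T \<longleftrightarrow> proper s T \<and> set (labels T) = {1..length s}"
  by (auto simp: decreasing_tree_def proper_def)

lemma proper_Leaf: "proper s Leaf"
  by (simp add: proper_def)

lemma pairwise_nth_Cons_iff:
  assumes "\<And>x y. D x y \<Longrightarrow> D y x"
  shows "(\<forall>i<length (x # xs). \<forall>j<length (x # xs). i \<noteq> j \<longrightarrow> D ((x # xs) ! i) ((x # xs) ! j)) \<longleftrightarrow>
     (\<forall>y\<in>set xs. D x y) \<and> (\<forall>i<length xs. \<forall>j<length xs. i \<noteq> j \<longrightarrow> D (xs ! i) (xs ! j))"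
  using assms by (simp add: All_less_Suc2 all_set_conv_all_nth) blast

text \<open>Disjointness compares positions and not members, since a node may have several equal
  children, all of them leaves.\<close>

lemma distinct_concat_labels_iff:
  "distinct (concat (map labels ts)) \<longleftrightarrow> (\<forall>t\<in>set ts. distinct (labels t)) \<and>
     (\<forall>i<length ts. \<forall>j<length ts. i \<noteq> j \<longrightarrow> set (labels (ts ! i)) \<inter> set (labels (ts ! j)) = {})"
proof (induction ts)
  case (Cons t ts)
  have "distinct (concat (map labels (t # ts))) \<longleftrightarrow> distinct (labels t) \<and>
      distinct (concat (map labels ts)) \<and> (\<forall>u\<in>set ts. set (labels t) \<inter> set (labels u) = {})"
    by auto
  then show ?case
    unfolding Cons
    by (subst pairwise_nth_Cons_iff[of "\<lambda>t u. set (labels t) \<inter> set (labels u) = {}"]) auto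
qed simp

lemma proper_Node_iff:
  "proper s (Node m ts) \<longleftrightarrow> length ts = part s m + 1 \<and>
     (\<forall>t\<in>set ts. proper s t \<and> (\<forall>j\<in>set (labels t). j < m)) \<and>
     (\<forall>i<length ts. \<forall>j<length ts. i \<noteq> j \<longrightarrow> set (labels (ts ! i)) \<inter> set (labels (ts ! j)) = {})"
  by (auto simp: proper_def distinct_concat_labels_iff) blast+

lemma labels_subtree: "U \<in> subtrees T \<Longrightarrow> set (labels U) \<subseteq> set (labels T)"
  by (induction T) auto

lemma in_child_labels:
  assumes "in_child T y i x"
  shows "y \<in> set (labels T)" "x \<in> set (labels T)"
proof -
  obtain ts where ts: "Node y ts \<in> subtrees T" "i < length ts" "x \<in> set (labels (ts ! i))"
    using assms by (auto simp: in_child_def)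
  then have "{y, x} \<subseteq> set (labels (Node y ts))" by auto
  then show "y \<in> set (labels T)" "x \<in> set (labels T)" using labels_subtree[OF ts(1)] by auto
qed

lemma in_child_less: "proper s T \<Longrightarrow> in_child T y i x \<Longrightarrow> x < y"
  unfolding proper_def in_child_def by (metis nth_mem)

lemma in_child_Node:
  "in_child (Node m ts) y k x \<longleftrightarrow>
     y = m \<and> k < length ts \<and> x \<in> set (labels (ts ! k)) \<or> (\<exists>t\<in>set ts. in_child t y k x)"
  by (auto simp: in_child_def)

section \<open>Descendants and inversions seen from the root\<close>

locale proper_node =
  fixes s :: "nat list" and m :: nat and ts :: "tree list"
  assumes proper: "proper s (Node m ts)"
begin

lemma length_children: "length ts = part s m + 1"
  using proper by (simp add: proper_Node_iff)

lemma proper_child: "t \<in> set ts \<Longrightarrow> proper s t"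
  using proper by (simp add: proper_Node_iff)

lemma label_less: "i < length ts \<Longrightarrow> x \<in> set (labels (ts ! i)) \<Longrightarrow> x < m"
  using proper by (auto simp: proper_Node_iff)

lemma child_unique:
  "\<lbrakk>i < length ts; j < length ts; x \<in> set (labels (ts ! i)); x \<in> set (labels (ts ! j))\<rbrakk> \<Longrightarrow> i = j"
  using proper unfolding proper_Node_iff by (metis disjoint_iff)

lemma label_cases:
  assumes "x \<in> set (labels (Node m ts))"
  obtains "x = m" | i where "i < length ts" "x \<in> set (labels (ts ! i))"
  using assms by (auto simp: in_set_conv_nth[of _ ts])

lemma in_labels: "i < length ts \<Longrightarrow> x \<in> set (labels (ts ! i)) \<Longrightarrow> x \<in> set (labels (Node m ts))"
  by (auto intro!: bexI[OF _ nth_mem])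

lemma in_child_root:
  "in_child (Node m ts) m k x \<longleftrightarrow> k < length ts \<and> x \<in> set (labels (ts ! k))"
proof -
  have "\<not> in_child t m k x" if "t \<in> set ts" for t
    using that in_child_labels(1)[of t m k x] proper by (auto simp: proper_Node_iff)
  then show ?thesis by (auto simp: in_child_Node)
qed

text \<open>One label in the child suffices: \<open>in_child\<close> within a child puts both labels
  there, and different children have disjoint labels.\<close>

lemma in_child_inner:
  assumes "i < length ts" "x \<in> set (labels (ts ! i)) \<or> y \<in> set (labels (ts ! i))" "y \<noteq> m"
  shows "in_child (Node m ts) y k x \<longleftrightarrow> in_child (ts ! i) y k x"
proof
  assume "in_child (Node m ts) y k x"
  then obtain j where "j < length ts" "in_child (ts ! j) y k x"
    using assms(3) by (auto simp: in_child_Node in_set_conv_nth[of _ ts])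
  then show "in_child (ts ! i) y k x"
    using child_unique[of i j] in_child_labels[of "ts ! j" y k x] assms by metis
qed (use assms in \<open>auto simp: in_child_Node\<close>)

lemma descendant_root:
  "descendant (Node m ts) x m \<longleftrightarrow> (\<exists>k<length ts. x \<in> set (labels (ts ! k)))"
  by (auto simp: descendant_def in_child_root)

lemma descendant_inner:
  assumes "i < length ts" "x \<in> set (labels (ts ! i)) \<or> y \<in> set (labels (ts ! i))" "y \<noteq> m"
  shows "descendant (Node m ts) x y \<longleftrightarrow> descendant (ts ! i) x y"
  using in_child_inner[OF assms] by (simp add: descendant_def)

lemma descendant_labels: "descendant T x y \<Longrightarrow> x \<in> set (labels T) \<and> y \<in> set (labels T)"
  using in_child_labels by (auto simp: descendant_def)

lemma not_descendant_of_leq: "y \<le> x \<Longrightarrow> \<not> descendant (Node m ts) x y"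
  using in_child_less[OF proper] by (fastforce simp: descendant_def)

lemma root_not_in_child: "i < length ts \<Longrightarrow> m \<notin> set (labels (ts ! i))"
  using label_less by blast

text \<open>The whole tree adds just the common ancestor \<open>m\<close>, of which every label of
  the child is a descendant, so the closest one does not change.\<close>

lemma first_common_ancestor_inner:
  assumes i: "i < length ts" "x \<in> set (labels (ts ! i))" "y \<in> set (labels (ts ! i))"
    and z: "z \<noteq> m"
  shows "first_common_ancestor (Node m ts) x y z \<longleftrightarrow> first_common_ancestor (ts ! i) x y z"
proof -
  have ca: "common_ancestor (Node m ts) x y w \<longleftrightarrow> w = m \<or> common_ancestor (ts ! i) x y w" for w
    using i descendant_root descendant_inner[of i x w] descendant_inner[of i y w]
      root_not_in_child[of i] descendant_labels[of "ts ! i" x m]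
    unfolding common_ancestor_def by blast
  have "descendant (Node m ts) z w \<longleftrightarrow> w = m \<or> descendant (ts ! i) z w"
    if "common_ancestor (ts ! i) x y z" for w
  proof -
    have "z \<in> set (labels (ts ! i))"
      using that descendant_labels by (auto simp: common_ancestor_def)
    then show ?thesis
      using i descendant_root descendant_inner[of i z w] descendant_labels[of "ts ! i" z m]
        root_not_in_child[of i] by blast
  qed
  moreover have "\<not> common_ancestor (ts ! i) x y m"
    using descendant_labels root_not_in_child[OF i(1)] unfolding common_ancestor_def by blast
  ultimately show ?thesis
    using z by (cases "common_ancestor (ts ! i) x y z") (auto simp: first_common_ancestor_def ca)
qed

lemma first_common_ancestor_apart:
  assumes "i < length ts" "j < length ts" "i \<noteq> j" "x \<in> set (labels (ts ! j))" "y \<in> set (labels (ts ! i))"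
  shows "first_common_ancestor (Node m ts) x y z \<longleftrightarrow> z = m"
proof -
  have "common_ancestor (Node m ts) x y w \<longleftrightarrow> w = m" for w
    using assms descendant_root descendant_inner[of j x w] descendant_inner[of i y w]
      descendant_labels[of "ts ! i" y w] descendant_labels[of "ts ! j" x w] child_unique[of i j w]
    unfolding common_ancestor_def by blast
  then show ?thesis unfolding first_common_ancestor_def by blast
qed

lemma left_of_inner:
  assumes i: "i < length ts" "x \<in> set (labels (ts ! i))" "y \<in> set (labels (ts ! i))"
  shows "left_of (Node m ts) x y \<longleftrightarrow> left_of (ts ! i) x y"
    and "right_of (Node m ts) x y \<longleftrightarrow> right_of (ts ! i) x y"
proof -
  \<comment> \<open>Left and right both imply \<open>j \<noteq> k\<close>, and this discards
    \<open>z = m\<close>, since \<open>x\<close> and \<open>y\<close> lie in the same child of the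
    root.\<close>
  have *: "first_common_ancestor (Node m ts) x y z \<and> in_child (Node m ts) z j x \<and>
        in_child (Node m ts) z k y \<and> j \<noteq> k \<longleftrightarrow>
      first_common_ancestor (ts ! i) x y z \<and> in_child (ts ! i) z j x \<and> in_child (ts ! i) z k y \<and> j \<noteq> k"
    for z j k
  proof (cases "z = m")
    case True
    then show ?thesis
      using i child_unique[of i j x] child_unique[of i k y] root_not_in_child[of i]
        in_child_labels(1)[of "ts ! i" m j x]
      by (auto simp: in_child_root)
  next
    case False
    then show ?thesis
      using i by (simp add: first_common_ancestor_inner in_child_inner[of i])
  qed
  show "left_of (Node m ts) x y \<longleftrightarrow> left_of (ts ! i) x y"
    unfolding left_of_def by (metis * less_irrefl)
  show "right_of (Node m ts) x y \<longleftrightarrow> right_of (ts ! i) x y"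
    unfolding right_of_def by (metis * less_irrefl)
qed

lemma inv_card_root:
  assumes i: "i < length ts" "x \<in> set (labels (ts ! i))"
  shows "inv_card s (Node m ts) m x = i"
proof -
  \<comment> \<open>The root is a descendant of no node, so \<open>inv_card\<close> falls to its
    last case.\<close>
  have "\<not> first_common_ancestor (Node m ts) x m z" for z
    by (metis common_ancestor_def descendant_labels first_common_ancestor_def label_cases label_less
        not_descendant_of_leq less_imp_le order_refl)
  then have "\<not> left_of (Node m ts) x m" "\<not> right_of (Node m ts) x m"
    by (auto simp: left_of_def right_of_def)
  moreover have "(THE k. in_child (Node m ts) m k x) = i"
    using i child_unique by (intro the_equality) (auto simp: in_child_root)
  ultimately show ?thesis by (simp add: inv_card_def)
qed

lemma inv_card_inner:
  assumes i: "i < length ts" "x \<in> set (labels (ts ! i))" "y \<in> set (labels (ts ! i))"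
  shows "inv_card s (Node m ts) y x = inv_card s (ts ! i) y x"
proof -
  have "y \<noteq> m" using i root_not_in_child by blast
  then show ?thesis
    using i by (simp add: inv_card_def left_of_inner in_child_inner[of i])
qed

lemma inv_card_apart:
  assumes ij: "i < length ts" "j < length ts" "i \<noteq> j"
      "x \<in> set (labels (ts ! j))" "y \<in> set (labels (ts ! i))"
  shows "inv_card s (Node m ts) y x = (if j < i then 0 else part s y)"
proof -
  have "in_child (Node m ts) m k x \<longleftrightarrow> k = j" "in_child (Node m ts) m k y \<longleftrightarrow> k = i" for k
    unfolding in_child_root using ij child_unique by metis+
  then show ?thesis
    using ij by (auto simp: inv_card_def left_of_def right_of_def first_common_ancestor_apart[OF ij])
qed

text \<open>This lets \<open>tree_eqI\<close> recover the label set of each child from row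
  \<open>m\<close>.\<close>

lemma child_labels_eq:
  assumes "i < length ts"
  shows "set (labels (ts ! i)) =
    {x \<in> set (labels (Node m ts)). x \<noteq> m \<and> inv_card s (Node m ts) m x = i}" (is "_ = ?R")
proof
  show "set (labels (ts ! i)) \<subseteq> ?R"
    using assms in_labels inv_card_root root_not_in_child by blast
  show "?R \<subseteq> set (labels (ts ! i))"
    using inv_card_root by (auto elim!: label_cases simp del: labels.simps)
qed

end

section \<open>From trees to inversion functions and back\<close>

lemma inversion_function_inv_card:
  "proper s T \<Longrightarrow> inversion_function (set (labels T)) (part s) (inv_card s T)"
proof (induction T)
  case Leaf
  show ?case by unfold_locales auto
next
  case (Node m ts)
  let ?T = "Node m ts"
  interpret proper_node s m ts by unfold_locales (rule Node.prems)
  have IH: "inversion_function (set (labels (ts ! i))) (part s) (inv_card s (ts ! i))"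
    if "i < length ts" for i
    using that Node.IH[of "ts ! i"] proper_child by simp
  have idx: "\<exists>i<length ts. x \<in> set (labels (ts ! i))"
    if "x \<in> set (labels ?T)" "y \<in> set (labels ?T)" "x < y" for x y
    using that label_less by (elim label_cases) (auto intro: less_asym)
  have bnd: "inv_card s ?T y x \<le> part s y"
    if xy: "x \<in> set (labels ?T)" "y \<in> set (labels ?T)" "x < y" for x y
  proof -
    obtain j where j: "j < length ts" "x \<in> set (labels (ts ! j))" using idx[OF xy] by blast
    show ?thesis
      using xy(2)
    proof (cases rule: label_cases)
      case 1
      then show ?thesis using j inv_card_root length_children by simp
    next
      case (2 i)
      then show ?thesis
        using j inversion_function.bound[OF IH[of i], of x y] xy
        by (cases "i = j") (auto simp: inv_card_inner inv_card_apart[of i j])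
    qed
  qed
  show ?case
  proof
    show "finite (set (labels ?T))" by simp
    show "inv_card s ?T y x \<le> part s y"
      if xy: "x \<in> set (labels ?T)" "y \<in> set (labels ?T)" "x < y" for x y
      using bnd that .
    fix x y z
    assume xyz: "x \<in> set (labels ?T)" "y \<in> set (labels ?T)" "z \<in> set (labels ?T)" "x < y" "y < z"
    obtain j where j: "j < length ts" "x \<in> set (labels (ts ! j))" using idx xyz by blast
    obtain i where i: "i < length ts" "y \<in> set (labels (ts ! i))" using idx xyz by blast
    have zx: "inv_card s ?T z x \<le> part s z" and zy: "inv_card s ?T z y \<le> part s z"
      using bnd xyz by auto
    show "inv_card s ?T z y \<le> inv_card s ?T z x" if pos: "0 < inv_card s ?T y x"
    proof -
      \<comment> \<open>If \<open>x\<close> were in an earlier child than \<open>y\<close>, the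
        entry would be 0. Given \<open>i \<le> j\<close>, only the case of a child shared by all
        three labels needs the induction hypothesis: entries of the root are child indices, and any
        other \<open>z\<close> has entry 0 for earlier children and the maximal entry
        \<open>part s z\<close> for later ones.\<close>
      have ij: "i \<le> j" using pos inv_card_apart[of i j] i j by (cases "i \<le> j") auto
      show ?thesis
        using xyz(3)
      proof (cases rule: label_cases)
        case 1
        then show ?thesis using ij inv_card_root[OF i] inv_card_root[OF j] by simp
      next
        case (2 l)
        then show ?thesis
          using i j ij zy pos inversion_function.transitive[OF IH[of l], of x y z] xyz
            inv_card_apart[of l i y z] inv_card_apart[of l j x z]
          by (cases "l = i"; cases "l = j") (auto simp: inv_card_inner)
      qed
    qed
    show "inv_card s ?T z x \<le> inv_card s ?T z y" if less: "inv_card s ?T y x < part s y"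
    proof -
      \<comment> \<open>Dually, an entry less than \<open>part s y\<close> excludes that
        \<open>x\<close> is in a later child than \<open>y\<close>.\<close>
      have ij: "j \<le> i" using less inv_card_apart[of i j] i j by (cases "j \<le> i") auto
      show ?thesis
        using xyz(3)
      proof (cases rule: label_cases)
        case 1
        then show ?thesis using ij inv_card_root[OF i] inv_card_root[OF j] by simp
      next
        case (2 l)
        then show ?thesis
          using i j ij zx less inversion_function.planar[OF IH[of l], of x y z] xyz
            inv_card_apart[of l i y z] inv_card_apart[of l j x z]
          by (cases "l = i"; cases "l = j") (auto simp: inv_card_inner)
      qed
    qed
  qed
qed

text \<open>Row \<open>m\<close> separates labels in different children of the root. Two labels in
  one child get equal entries from the root and from each label of another child, so the condition
  reduces to that child.\<close>

lemma in_child_iff_inv_card: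
  "\<lbrakk>proper s T; x \<in> set (labels T); y \<in> set (labels T)\<rbrakk> \<Longrightarrow>
   in_child T y k x \<longleftrightarrow> x < y \<and> inv_card s T y x = k \<and>
     (\<forall>z\<in>set (labels T). y < z \<longrightarrow> inv_card s T z x = inv_card s T z y)"
proof (induction T)
  case Leaf
  then show ?case by simp
next
  case (Node m ts)
  let ?T = "Node m ts"
  interpret proper_node s m ts by unfold_locales (rule Node.prems)
  have max: "z \<le> m" if "z \<in> set (labels ?T)" for z
    using that label_less by (elim label_cases) (auto intro: less_imp_le)
  have mT: "m \<in> set (labels ?T)" by simp
  show ?case
    using Node.prems(3)
  proof (cases rule: label_cases)
    case y: 1
    show ?thesis
      using Node.prems(2)
    proof (cases rule: label_cases)
      case 1
      then show ?thesis using y in_child_less[OF proper] by blast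
    next
      case (2 j)
      moreover have "\<forall>z\<in>set (labels ?T). \<not> m < z" using max leD by blast
      ultimately show ?thesis
        using y label_less[of j x] child_unique[of j k x]
        by (auto simp: in_child_root inv_card_root simp del: labels.simps)
    qed
  next
    case y: (2 i)
    show ?thesis
      using Node.prems(2)
    proof (cases rule: label_cases)
      case 1
      then show ?thesis using y label_less[of i y] in_child_less[OF proper, of y k x] by auto
    next
      case x: (2 j)
      show ?thesis
      proof (cases "i = j")
        case False
        then have "\<not> in_child ?T y k x"
          using x y child_unique in_child_inner[of i x y] in_child_labels root_not_in_child by metis
        moreover have "inv_card s ?T m x \<noteq> inv_card s ?T m y" "y < m"
          using False x y label_less by (auto simp: inv_card_root)
        ultimately show ?thesis using mT by blast
      next
        case True
        then have x: "x \<in> set (labels (ts ! i))" using x by simp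
        have "(\<forall>z\<in>set (labels ?T). y < z \<longrightarrow> inv_card s ?T z x = inv_card s ?T z y) \<longleftrightarrow>
          (\<forall>z\<in>set (labels (ts ! i)). y < z \<longrightarrow> inv_card s (ts ! i) z x = inv_card s (ts ! i) z y)"
          (is "?A \<longleftrightarrow> ?B")
        proof
          show ?B if ?A
            using that in_labels[OF y(1)] inv_card_inner[OF y(1)] x y(2) by metis
          show ?A if ?B
          proof (intro ballI impI)
            fix z assume z: "z \<in> set (labels ?T)" "y < z"
            show "inv_card s ?T z x = inv_card s ?T z y"
              using z(1)
            proof (cases rule: label_cases)
              case 1
              then show ?thesis using x y by (simp add: inv_card_root)
            next
              case (2 l)
              then show ?thesis using x y z that
                by (cases "l = i") (auto simp: inv_card_inner inv_card_apart[of l i])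
            qed
          qed
        qed
        then show ?thesis
          using Node.IH[of "ts ! i"] x y proper_child in_child_inner[of i x y] root_not_in_child[of i]
            inv_card_inner[of i x y]
          by (metis nth_mem)
      qed
    qed
  qed
qed

text \<open>Both roots are the largest label, its row determines the label sets of the children, and
  the children agree by induction.\<close>

lemma tree_eqI:
  "\<lbrakk>proper s T; proper s T'; set (labels T) = set (labels T');
    \<And>x y. \<lbrakk>x \<in> set (labels T); y \<in> set (labels T); x < y\<rbrakk> \<Longrightarrow> inv_card s T y x = inv_card s T' y x\<rbrakk>
   \<Longrightarrow> T = T'"
proof (induction T arbitrary: T')
  case Leaf
  then show ?case by (cases T') auto
next
  case (Node m ts)
  obtain m' ts' where T': "T' = Node m' ts'" using Node.prems(3) by (cases T') auto
  interpret proper_node s m ts by unfold_locales (rule Node.prems)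
  interpret T': proper_node s m' ts' by unfold_locales (use Node.prems T' in simp)
  have same: "set (labels (Node m ts)) = set (labels (Node m' ts'))"
    using Node.prems(3) T' by simp
  have le: "x \<le> m" if "x \<in> set (labels (Node m ts))" for x
    using that label_less by (elim label_cases) (auto intro: less_imp_le)
  have le': "x \<le> m'" if "x \<in> set (labels (Node m' ts'))" for x
    using that T'.label_less by (elim T'.label_cases) (auto intro: less_imp_le)
  have m: "m' = m"
    using le[of m'] le'[of m] unfolding same[symmetric] using same by auto
  have eq: "inv_card s (Node m ts) y x = inv_card s (Node m' ts') y x"
    if "x \<in> set (labels (Node m ts))" "y \<in> set (labels (Node m ts))" "x < y" for x y
    using Node.prems(4)[OF that] T' by simp
  have "ts = ts'"
  proof (rule nth_equalityI)
    show len: "length ts = length ts'" using length_children T'.length_children m by simp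
    fix i assume i: "i < length ts"
    have i': "i < length ts'" using i len by simp
    have "inv_card s (Node m ts) m x = inv_card s (Node m' ts') m' x"
      if "x \<in> set (labels (Node m ts))" "x \<noteq> m" for x
      using eq[of x m] le[of x] that m by simp
    then have lab: "set (labels (ts ! i)) = set (labels (ts' ! i))"
      unfolding child_labels_eq[OF i] T'.child_labels_eq[OF i']
      using same m by (auto simp del: labels.simps)
    show "ts ! i = ts' ! i"
    proof (rule Node.IH)
      show "inv_card s (ts ! i) y x = inv_card s (ts' ! i) y x"
        if "x \<in> set (labels (ts ! i))" "y \<in> set (labels (ts ! i))" "x < y" for x y
        using eq[of x y] in_labels[OF i] that inv_card_inner[OF i] T'.inv_card_inner[OF i'] lab
        by simp
    qed (use i i' lab proper_child T'.proper_child in auto)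
  qed
  then show ?case using T' m by simp
qed

text \<open>The largest label \<open>m\<close> becomes the root, and the fibres of its row become
  the label sets of the children. Entries between different fibres are forced to 0 or
  \<open>part s y\<close> by transitivity and planarity with \<open>m\<close> as third
  label.\<close>

lemma exists_tree:
  "inversion_function X (part s) f \<Longrightarrow>
   \<exists>T. proper s T \<and> set (labels T) = X \<and> (\<forall>x\<in>X. \<forall>y\<in>X. x < y \<longrightarrow> inv_card s T y x = f y x)"
proof (induction "card X" arbitrary: X rule: less_induct)
  case less
  interpret inversion_function X "part s" f by fact
  show ?case
  proof (cases "X = {}")
    case True
    then show ?thesis by (intro exI[of _ Leaf]) (simp add: proper_Leaf)
  next
    case False
    define m where "m = Max X"
    have max: "x \<le> m" if "x \<in> X" for x
      using finite_X False that by (auto simp: m_def)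
    have mX: "m \<in> X" using finite_X False by (simp add: m_def)
    define P where "P i = {x \<in> X. x < m \<and> f m x = i}" for i
    have "\<exists>T. proper s T \<and> set (labels T) = P i \<and>
        (\<forall>x\<in>P i. \<forall>y\<in>P i. x < y \<longrightarrow> inv_card s T y x = f y x)" for i
    proof (rule less.hyps)
      show "card (P i) < card X"
        using finite_X mX by (intro psubset_card_mono) (auto simp: P_def)
      show "inversion_function (P i) (part s) f"
        by (rule inversion_function_subset[OF less.prems]) (auto simp: P_def)
    qed
    then obtain t where t: "\<And>i. proper s (t i)" "\<And>i. set (labels (t i)) = P i"
      "\<And>i x y. \<lbrakk>x \<in> P i; y \<in> P i; x < y\<rbrakk> \<Longrightarrow> inv_card s (t i) y x = f y x"
      by metis
    \<comment> \<open>By \<open>bound\<close>, every value of row \<open>m\<close> is a position in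
      this list; an empty fibre yields a leaf.\<close>
    define ts where "ts = map t [0..<part s m + 1]"
    have len: "length ts = part s m + 1" by (simp add: ts_def)
    have nth: "ts ! i = t i" if "i < length ts" for i
      using that by (simp add: ts_def del: upt_Suc)
    interpret T: proper_node s m ts
    proof
      show "proper s (Node m ts)"
        unfolding proper_Node_iff
        using t(1,2) nth len by (auto simp: ts_def P_def simp del: upt_Suc)
    qed
    have idx: "f m x < length ts" if "x \<in> X" "x < m" for x
      using bound[of x m] mX that len by simp
    have lab: "set (labels (Node m ts)) = X"
    proof
      show "set (labels (Node m ts)) \<subseteq> X"
        using t(2) nth mX by (auto elim!: T.label_cases simp: P_def simp del: labels.simps)
      show "X \<subseteq> set (labels (Node m ts))"
      proof
        fix x assume x: "x \<in> X"
        show "x \<in> set (labels (Node m ts))"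
        proof (cases "x = m")
          case False
          then have "x < m" using max[OF x] by simp
          then show ?thesis
            using T.in_labels[of "f m x" x] idx[of x] x t(2)[of "f m x"] nth by (simp add: P_def)
        qed simp
      qed
    qed
    have "inv_card s (Node m ts) y x = f y x" if xy: "x \<in> X" "y \<in> X" "x < y" for x y
    proof -
      have xm: "x < m" using xy max[of y] by simp
      define j where "j = f m x"
      have j: "j < length ts" "x \<in> set (labels (ts ! j))" "x \<in> P j"
        using idx[of x] xm xy t(2) nth by (auto simp: j_def P_def)
      show ?thesis
      proof (cases "y = m")
        case True
        then show ?thesis using T.inv_card_root[OF j(1,2)] by (simp add: j_def)
      next
        case False
        then have ym: "y < m" using max[of y] xy by simp
        define i where "i = f m y"
        have i: "i < length ts" "y \<in> set (labels (ts ! i))" "y \<in> P i"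
          using idx[of y] ym xy t(2) nth by (auto simp: i_def P_def)
        consider "i = j" | "j < i" | "i < j" by linarith
        then show ?thesis
        proof cases
          case 1
          then show ?thesis using T.inv_card_inner[of i x y] i j t(3)[of x i y] xy nth by simp
        next
          case 2
          then have "f y x = 0" using transitive[of x y m] xy ym mX by (auto simp: i_def j_def)
          then show ?thesis using T.inv_card_apart[of i j x y] i j 2 by simp
        next
          case 3
          then have "f y x = part s y"
            using planar[of x y m] bound[of x y] xy ym mX by (force simp: i_def j_def)
          then show ?thesis using T.inv_card_apart[of i j x y] i j 3 by simp
        qed
      qed
    qed
    then show ?thesis using T.proper lab by blast
  qed
qed

section \<open>Cover relations\<close>

theorem theorem1p32:
  fixes s :: "nat list" and T T' :: tree
  assumes "decreasing_tree s T" and "decreasing_tree s T'"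
  shows "covers s T' T \<longleftrightarrow>
    (\<exists>a c. tree_ascent s T a c \<and>
       tree_inversions s T' = tc (add_mset (c, a) (tree_inversions s T)))"
proof -
  define X where "X = {1..length s}"
  let ?f = "inv_card s T"
  have T: "proper s T" "set (labels T) = X" and T': "proper s T'" "set (labels T') = X"
    using assms by (auto simp: decreasing_tree_iff_proper X_def)
  have inv: "inversion_function X (part s) (inv_card s U)" if "decreasing_tree s U" for U
    using that inversion_function_inv_card[of s U] by (simp add: decreasing_tree_iff_proper X_def)
  have le_iff: "weak_le s U V \<longleftrightarrow>
      (\<forall>x\<in>X. \<forall>y\<in>X. x < y \<longrightarrow> inv_card s U y x \<le> inv_card s V y x)" for U V
    unfolding weak_le_def X_def by fastforce
  have eqI: "U = V" if "decreasing_tree s U" "decreasing_tree s V"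
      "\<forall>x\<in>X. \<forall>y\<in>X. x < y \<longrightarrow> inv_card s U y x = inv_card s V y x" for U V
    using that tree_eqI[of s U V] by (simp add: decreasing_tree_iff_proper X_def)
  have count_inv: "count (tree_inversions s U) (y, x) =
      (if x \<in> X \<and> y \<in> X \<and> x < y then inv_card s U y x else 0)" for U x y
    by (auto simp: count_tree_inversions X_def)
  interpret inversion_function X "part s" ?f by (rule inv[OF assms(1)])
  have child: "in_child T y k x \<longleftrightarrow> below x y \<and> ?f y x = k" for x y k
    using in_child_iff_inv_card[OF T(1), of x y k] in_child_labels[of T y k x]
    unfolding T(2) below_def by blast
  have desc: "descendant T x y \<longleftrightarrow> below x y" for x y
    by (simp add: descendant_def child)
  have ascent: "tree_ascent s T a c \<longleftrightarrow> ascent a c" for a c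
  proof -
    \<comment> \<open>By the bound, not lying in the last child of \<open>c\<close> amounts to an
      entry less than \<open>part s c\<close>.\<close>
    have "below a c \<Longrightarrow> a < c \<and> ?f c a \<le> part s c" using bound[of a c] by (simp add: below_def)
    then show ?thesis
      unfolding tree_ascent_def ascent_def rightmost_below_def child desc by fastforce
  qed
  have tc: "count (tc (add_mset (c, a) (tree_inversions s T))) (y, x) =
      (if x \<in> X \<and> y \<in> X \<and> x < y then rotation a c y x else 0)" if "ascent a c" for a c x y
    unfolding count_tc by (rule tc_card_rotation[OF that count_inv])
  have rot_iff: "tree_inversions s T' = tc (add_mset (c, a) (tree_inversions s T)) \<longleftrightarrow>
      (\<forall>x\<in>X. \<forall>y\<in>X. x < y \<longrightarrow> inv_card s T' y x = rotation a c y x)" if "ascent a c" for a c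
  proof -
    have "tree_inversions s T' = tc (add_mset (c, a) (tree_inversions s T)) \<longleftrightarrow>
        (\<forall>y x. count (tree_inversions s T') (y, x) =
          count (tc (add_mset (c, a) (tree_inversions s T))) (y, x))"
      by (auto simp: multiset_eq_iff)
    then show ?thesis unfolding tc[OF that] count_inv by (auto split: if_splits)
  qed
  \<comment> \<open>This joins \<open>exists_ascent\<close> and \<open>rotation_le\<close>. It
    serves both directions, for \<open>U = T'\<close> and for \<open>U\<close> between
    \<open>T\<close> and \<open>T'\<close>.\<close>
  have ex: "\<exists>a c. ascent a c \<and> ?f c a < inv_card s U c a \<and>
      (\<forall>x\<in>X. \<forall>y\<in>X. x < y \<longrightarrow> rotation a c y x \<le> inv_card s U y x)"
    if U: "decreasing_tree s U" and less: "weak_less s T U" for U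
  proof -
    have le: "?f y x \<le> inv_card s U y x" if "x \<in> X" "y \<in> X" "x < y" for x y
      using less that by (simp add: weak_less_def le_iff)
    obtain x y where "x \<in> X" "y \<in> X" "x < y" "?f y x \<noteq> inv_card s U y x"
      using eqI[OF assms(1) U] less by (auto simp: weak_less_def)
    then obtain a c where ac: "ascent a c" "?f c a < inv_card s U c a"
      using exists_ascent[OF inv[OF U]] le by blast
    show ?thesis
      using ac rotation_le[OF inv[OF U] ac(1) le ac(2)] by blast
  qed
  show ?thesis
  proof
    assume cov: "covers s T' T"
    then have "weak_less s T T'" by (simp add: covers_def)
    from ex[OF assms(2) this] obtain a c where asc: "ascent a c"
      and le: "\<forall>x\<in>X. \<forall>y\<in>X. x < y \<longrightarrow> rotation a c y x \<le> inv_card s T' y x" by blast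
    \<comment> \<open>\<open>R\<close> realises the rotation as a tree. It lies strictly above
      \<open>T\<close> and weakly below \<open>T'\<close>, so the cover relation forces
      \<open>R = T'\<close>.\<close>
    obtain R where R: "decreasing_tree s R"
      "\<forall>x\<in>X. \<forall>y\<in>X. x < y \<longrightarrow> inv_card s R y x = rotation a c y x"
      using exists_tree[OF inversion_function_rotation[OF asc]]
      by (auto simp: decreasing_tree_iff_proper X_def)
    have ac: "a \<in> X" "c \<in> X" "a < c" using asc by (auto simp: ascent_def below_def)
    have "inv_card s R c a = Suc (?f c a)" using R(2) ac rotation_self by metis
    then have "R \<noteq> T" by auto
    then have "weak_less s T R" using R(2) rotation_ge by (auto simp: weak_less_def le_iff)
    moreover have "weak_le s R T'" using R(2) le by (simp add: le_iff)
    ultimately have "R = T'" using cov R(1) by (auto simp: covers_def weak_less_def)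
    then show "\<exists>a c. tree_ascent s T a c \<and>
       tree_inversions s T' = tc (add_mset (c, a) (tree_inversions s T))"
      using asc R(2) rot_iff ascent by blast
  next
    assume "\<exists>a c. tree_ascent s T a c \<and>
       tree_inversions s T' = tc (add_mset (c, a) (tree_inversions s T))"
    then obtain a c where asc: "ascent a c"
      and rot: "\<forall>x\<in>X. \<forall>y\<in>X. x < y \<longrightarrow> inv_card s T' y x = rotation a c y x"
      using rot_iff ascent by blast
    have ac: "a \<in> X" "c \<in> X" "a < c" using asc by (auto simp: ascent_def below_def)
    have "inv_card s T' c a = Suc (?f c a)" using rot ac rotation_self by metis
    then have "T \<noteq> T'" by auto
    then have less: "weak_less s T T'" using rot rotation_ge by (auto simp: weak_less_def le_iff)
    \<comment> \<open>\<open>U\<close> lies above the rotation at some ascent of \<open>T\<close>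
      and below the one at \<open>(a, c)\<close>. By \<open>ascent_unique\<close> the two ascents
      coincide, which squeezes \<open>U\<close> to \<open>T'\<close>.\<close>
    have "U = T'" if U: "decreasing_tree s U" "weak_less s T U" "weak_le s U T'" for U
    proof -
      obtain a' c' where asc': "ascent a' c'" "?f c' a' < inv_card s U c' a'"
        and le: "\<forall>x\<in>X. \<forall>y\<in>X. x < y \<longrightarrow> rotation a' c' y x \<le> inv_card s U y x"
        using ex[OF U(1,2)] by blast
      have UT': "\<forall>x\<in>X. \<forall>y\<in>X. x < y \<longrightarrow> inv_card s U y x \<le> rotation a c y x"
        using U(3) rot by (auto simp: le_iff)
      have "a' \<in> X" "c' \<in> X" "a' < c'" using asc' by (auto simp: ascent_def below_def)
      then have "?f c' a' < rotation a c c' a'" using asc'(2) UT' by (meson less_le_trans)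
      then have "a' = a" "c' = c" using ascent_unique[OF asc asc'(1)] by auto
      then show "U = T'" using eqI[OF U(1) assms(2)] le UT' rot by (metis antisym)
    qed
    then show "covers s T' T"
      using assms less by (auto simp: covers_def weak_less_def)
  qed
qed

end
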